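(* Let $c=0$ and let $z_0\in\mathbb{R}$ satisfy $z_0>0$ and $z_0\neq 1$. Then the Exponent Set $E(z_0,0)$ admits no finite universal escape radius. More precisely, for every real $r>0$ there exists an exponent $x\in E(z_0,0)$ such that the orbit generated by $z_{n+1}=z_n^{\,x}$ from $z_0$ satisfies $|z_n|>r$ for some $n\ge 0$, while the orbit remains bounded.
   Context: Complex powers: for $z\in\mathbb{C}\setminus\{0\}$ let $\log z=\ln|z|+i\operatorname{Arg}(z)$ with $\operatorname{Arg}(z)\in(-\pi,\pi]$ (so $\operatorname{Arg}(-a)=\pi$ for $a>0$), and for $x\in\mathbb{C}$ set $z^x=\exp(x\log z)$. For $z=0$: $0^x=0$ if $\operatorname{Re}(x)>0$, and $0^x$ is undefined if $\operatorname{Re}(x)\le 0$. For $(z_0,c,x)\in\mathbb{C}^3$, the orbit $\{z_n\}$ is generated by $z_{n+1}=z_n^{\,x}+c$, continuing as long as the next iterate is defined and terminating otherwise. Exponent Set: for fixed $z_0,c\in\mathbb{C}$, $E(z_0,c)$ is the set of all $x\in\mathbb{C}$ such that $z_n$ is defined for every $n\ge 0$ and $\sup_{n\ge0}|z_n|<\infty$. Universal escape radius: for fixed $z_0,c\in\mathbb{C}$, a finite number $r>0$ is called a universal escape radius for $E(z_0,c)$ if, for every $x\in\mathbb{C}$ for which the orbit is well-defined for all $n\ge 0$, the existence of some $n\ge0$ with $|z_n|>r$ implies $x\notin E(z_0,c)$. *)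

theory Defs
  imports "HOL-Analysis.Complex_Transcendental"
begin

text \<open>
  The partial complex power. The library's \<^term>\<open>z powr x\<close> is
  \<^term>\<open>exp (x * Ln z)\<close> for \<^prop>\<open>z \<noteq> (0::complex)\<close>, where \<^const>\<open>Ln\<close> is the
  principal logarithm with imaginary part in \<open>(-pi, pi]\<close>; and it is \<open>0\<close> for every
  exponent if \<^prop>\<open>z = (0::complex)\<close>, which agrees with the intended value only when
  \<^prop>\<open>Re x > 0\<close>. \<^const>\<open>None\<close> stands for ``undefined''.
\<close>

definition cpow :: "complex \<Rightarrow> complex \<Rightarrow> complex option" where
  "cpow z x = (if z \<noteq> 0 \<or> Re x > 0 then Some (z powr x) else None)"

text \<open>An orbit that has terminated stays at \<^const>\<open>None\<close>.\<close>

primrec orbit :: "complex \<Rightarrow> complex \<Rightarrow> complex \<Rightarrow> nat \<Rightarrow> complex option" where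
  "orbit z0 c x 0 = Some z0"
| "orbit z0 c x (Suc n) =
     Option.bind (orbit z0 c x n) (\<lambda>z. map_option (\<lambda>w. w + c) (cpow z x))"

definition orbit_defined :: "complex \<Rightarrow> complex \<Rightarrow> complex \<Rightarrow> bool" where
  "orbit_defined z0 c x \<longleftrightarrow> (\<forall>n. orbit z0 c x n \<noteq> None)"

text \<open>Only meaningful in conjunction with \<^const>\<open>orbit_defined\<close>, because of \<^const>\<open>the\<close>.\<close>

definition orbit_bounded :: "complex \<Rightarrow> complex \<Rightarrow> complex \<Rightarrow> bool" where
  "orbit_bounded z0 c x \<longleftrightarrow> bdd_above (range (\<lambda>n. cmod (the (orbit z0 c x n))))"

definition exponent_set :: "complex \<Rightarrow> complex \<Rightarrow> complex set" where
  "exponent_set z0 c = {x. orbit_defined z0 c x \<and> orbit_bounded z0 c x}"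

definition universal_escape_radius :: "complex \<Rightarrow> complex \<Rightarrow> real \<Rightarrow> bool" where
  "universal_escape_radius z0 c r \<longleftrightarrow>
     r > 0 \<and>
     (\<forall>x. orbit_defined z0 c x \<longrightarrow>
        (\<exists>n. cmod (the (orbit z0 c x n)) > r) \<longrightarrow> x \<notin> exponent_set z0 c)"

end

theory Submission
  imports Defs
begin

text \<open>
  The point \<open>1\<close> is fixed by every power map, so an orbit that reaches \<open>1\<close> is bounded,
  whatever it did before. It therefore suffices to find exponents for which \<open>z\<^sub>1\<close> is as
  large as desired while \<open>z\<^sub>2 = 1\<close>.

  Write \<open>L = ln z\<^sub>0\<close>, a nonzero real. If \<open>x L = w + 2 \<pi> i m\<close> with \<open>m\<close> an integer and
  \<open>w = s + i d\<close> in the strip \<open>-\<pi> < Im w \<le> \<pi>\<close>, then \<open>z\<^sub>1 = exp w\<close> has principal logarithm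
  \<open>w\<close>, so \<open>|z\<^sub>1| = exp s\<close> and \<open>z\<^sub>2 = exp (x w)\<close>, where
  \<open>x w L = s\<^sup>2 - d (d + 2 \<pi> m) + 2 i s (d + \<pi> m)\<close>.
  Hence \<open>z\<^sub>2 = 1\<close> as soon as \<open>s\<^sup>2 = d (d + 2 \<pi> m)\<close> and \<open>s (d + \<pi> m)\<close> is an integer
  multiple of \<open>\<pi> L\<close>. The first equation makes \<open>s\<close> a continuous function of \<open>d\<close>, which grows
  from \<open>0\<close> to \<open>\<pi> sqrt (1 + 2 m)\<close> on \<open>[0, \<pi>]\<close>; the second is met by an intermediate
  value of \<open>d\<close> for which \<open>s\<close> falls short of its maximum by less than \<open>|L|\<close>
  (\<open>resonant_strip_point\<close>). Large \<open>m\<close> then gives large \<open>s\<close>. The multiple \<open>2 \<pi> m\<close> that the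
  principal logarithm discards is what permits a large \<open>Re w\<close> although \<open>Im w\<close> stays in the
  strip.
\<close>

text \<open>
  The value \<open>s (d + \<pi> m)\<close> at \<open>d = \<pi>\<close> is rounded down to a multiple of \<open>\<pi> a\<close>, which loses
  less than \<open>\<pi> a\<close>. As \<open>d + \<pi> m\<close> is at most \<open>\<pi> (1 + m)\<close>, the corresponding loss in \<open>s\<close> is
  less than \<open>a\<close>, uniformly in \<open>m\<close>.
\<close>

lemma resonant_strip_point:
  fixes a R :: real
  assumes "a > 0"
  obtains s d :: real and m k :: nat
  where "0 \<le> d" "d \<le> pi" "s > R"
    "s\<^sup>2 = d * (d + 2 * pi * m)" "s * (d + pi * m) = pi * a * k"
proof -
  obtain m :: nat where m: "(\<bar>R\<bar> + a)\<^sup>2 \<le> real m"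
    using real_arch_simple by blast
  define S where "S = (\<lambda>d. sqrt (d * (d + 2 * pi * m)))"
  define f where "f = (\<lambda>d. S d * (d + pi * m))"
  have Spi: "S pi \<ge> R + a"
  proof -
    have "(\<bar>R\<bar> + a)\<^sup>2 \<le> 1 + 2 * real m" using m by linarith
    also have "\<dots> \<le> pi * pi * (1 + 2 * real m)"
      using pi_gt3 mult_mono[of 1 pi 1 pi] by (simp add: mult_le_cancel_right1)
    also have "\<dots> = pi * (pi + 2 * pi * m)" by (simp add: algebra_simps)
    finally have "\<bar>R\<bar> + a \<le> S pi"
      unfolding S_def by (rule real_le_rsqrt)
    then show ?thesis by linarith
  qed
  define k where "k = nat \<lfloor>f pi / (pi * a)\<rfloor>"
  have fpi: "f pi \<ge> 0" by (simp add: f_def S_def)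
  have pa: "pi * a > 0" using assms by simp
  have k1: "real k \<le> f pi / (pi * a)" and k2: "f pi / (pi * a) < real k + 1"
    using fpi pa unfolding k_def by (auto simp: of_nat_nat)
  have up: "pi * a * k \<le> f pi" and low: "f pi < pi * a * k + pi * a"
    using k1 k2 pa by (simp_all add: field_simps)
  have "continuous_on {0..pi} f"
    unfolding f_def S_def by (intro continuous_intros)
  then obtain d where d: "0 \<le> d" "d \<le> pi" "f d = pi * a * k"
    using IVT'[of f 0 "pi * a * k" pi] up assms by (auto simp: f_def S_def)
  have S0: "S d \<ge> 0" using d by (simp add: S_def)
  have "S d > R"
  proof -
    have pos: "pi + pi * m > 0" by (simp add: add_pos_nonneg)
    have "S pi * (pi + pi * m) < f d + pi * a"
      using low d by (simp add: f_def)
    also have "f d \<le> S d * (pi + pi * m)"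
      unfolding f_def using S0 d by (intro mult_left_mono) auto
    also have "pi * a \<le> a * (pi + pi * m)"
      using assms by (simp add: algebra_simps)
    finally have "S pi * (pi + pi * m) < (S d + a) * (pi + pi * m)"
      by (simp add: algebra_simps)
    then have "S pi < S d + a" using pos by (simp add: mult_less_cancel_right)
    then show ?thesis using Spi by linarith
  qed
  moreover have "(S d)\<^sup>2 = d * (d + 2 * pi * m)"
    using d by (simp add: S_def)
  ultimately show thesis
    using that[of d "S d" m k] d by (simp add: f_def)
qed

text \<open>
  Here \<open>w\<close> becomes the principal logarithm of \<open>z\<^sub>1\<close>, and the last equation says that \<open>z\<^sub>2 = 1\<close>.
\<close>

lemma large_step_then_one:
  fixes L R :: real
  assumes "L \<noteq> 0"
  obtains x w :: complex
  where "exp (x * L) = exp w" "- pi < Im w" "Im w \<le> pi" "Re w > R" "exp (x * w) = 1"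
proof -
  obtain s d :: real and m k :: nat
    where d: "0 \<le> d" "d \<le> pi" and s: "s > R"
      and real_part: "s\<^sup>2 = d * (d + 2 * pi * m)"
      and imag_part: "s * (d + pi * m) = pi * \<bar>L\<bar> * k"
    using resonant_strip_point[of "\<bar>L\<bar>" R] assms by (metis zero_less_abs_iff)
  define w where "w = Complex s d"
  define x where "x = (w + 2 * of_nat m * pi * \<i>) / L"
  \<comment> \<open>\<open>k\<close> resonates with \<open>|L|\<close>; the sign of \<open>L\<close> is absorbed
    into \<open>j\<close>, the number of turns \<open>x w / (2 \<pi> i)\<close>.\<close>
  define j :: real where "j = sgn L * k"
  have j: "j \<in> \<int>" by (auto simp: j_def sgn_if)
  have jL: "j * L = \<bar>L\<bar> * k" by (simp add: j_def sgn_if)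
  have "x * L = w + 2 * of_nat m * pi * \<i>"
    using assms by (simp add: x_def)
  then have "exp (x * L) = exp w"
    using exp_integer_2pi[of "of_nat m"] by (simp add: exp_add)
  moreover have "exp (x * w) = 1"
  proof -
    have "(w + 2 * of_nat m * pi * \<i>) * w = 2 * (j * L) * pi * \<i>"
      unfolding jL using real_part imag_part
      by (simp add: complex_eq_iff w_def power2_eq_square algebra_simps)
    then have "x * w = 2 * of_real j * pi * \<i>"
      using assms by (simp add: x_def field_simps)
    then show ?thesis using exp_integer_2pi[OF j] by simp
  qed
  moreover have "- pi < Im w" using d(1) pi_gt_zero unfolding w_def complex.sel by linarith
  ultimately show thesis using that[of x w] d s by (simp add: w_def)
qed

lemma orbit_zero_Suc:
  assumes "orbit z0 0 x n = Some z" and "z \<noteq> 0"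
  shows "orbit z0 0 x (Suc n) = Some (z powr x)"
  using assms by (simp add: cpow_def)

lemma orbit_stays_one:
  assumes "orbit z0 0 x n = Some 1"
  shows "orbit z0 0 x (n + k) = Some 1"
proof (induction k)
  case (Suc k)
  then show ?case using orbit_zero_Suc[of z0 x "n + k" 1] by simp
qed (simp add: assms)

lemma reaching_one_in_exponent_set:
  assumes one: "orbit z0 0 x N = Some 1"
  shows "x \<in> exponent_set z0 0"
proof -
  have tail: "orbit z0 0 x n = Some 1" if "N \<le> n" for n
    using orbit_stays_one[OF one, of "n - N"] that by simp
  have "orbit z0 0 x n \<noteq> None" for n
  proof (cases "N \<le> n")
    case False
    \<comment> \<open>Termination is permanent, so it cannot have happened before stage \<open>N\<close>.\<close>
    have "orbit z0 0 x (n + k) = None" if "orbit z0 0 x n = None" for k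
      using that by (induction k) auto
    from this[of "N - n"] show ?thesis using False one by auto
  qed (simp add: tail)
  moreover have "bdd_above (range (\<lambda>n. cmod (the (orbit z0 0 x n))))"
  proof -
    have "range (\<lambda>n. cmod (the (orbit z0 0 x n)))
        \<subseteq> (\<lambda>n. cmod (the (orbit z0 0 x n))) ` {..N} \<union> {1}"
    proof (rule image_subsetI)
      fix n
      show "cmod (the (orbit z0 0 x n))
          \<in> (\<lambda>n. cmod (the (orbit z0 0 x n))) ` {..N} \<union> {1}"
        by (cases "N \<le> n") (simp_all add: tail)
    qed
    then show ?thesis by (rule bdd_above_mono[rotated]) simp
  qed
  ultimately show ?thesis
    by (simp add: exponent_set_def orbit_defined_def orbit_bounded_def)
qed

lemma exponent_with_large_bounded_orbit:
  fixes z0 r :: real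
  assumes "z0 > 0" and "z0 \<noteq> 1" and "r > 0"
  obtains x where "x \<in> exponent_set (complex_of_real z0) 0"
    and "cmod (the (orbit (complex_of_real z0) 0 x 1)) > r"
proof -
  have "ln z0 \<noteq> 0" using assms by simp
  then obtain x w :: complex where x1: "exp (x * ln z0) = exp w"
    and w: "- pi < Im w" "Im w \<le> pi" "Re w > ln r"
    and x2: "exp (x * w) = 1"
    by (rule large_step_then_one[of "ln z0" "ln r"])
  let ?z = "complex_of_real z0"
  have "?z powr x = exp w"
    using assms x1 by (simp add: powr_def Ln_of_real)
  then have z1: "orbit ?z 0 x 1 = Some (exp w)"
    using orbit_zero_Suc[of ?z x 0 ?z] assms by simp
  have "exp w powr x = 1"
    using w x2 by (simp add: powr_def)
  then have "orbit ?z 0 x 2 = Some 1"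
    using orbit_zero_Suc[OF z1] by (simp add: numeral_2_eq_2)
  then have "x \<in> exponent_set ?z 0" by (rule reaching_one_in_exponent_set)
  moreover have "cmod (exp w) > r"
    using w(3) assms(3) by (metis exp_less_mono exp_ln norm_exp_eq_Re)
  ultimately show thesis using that z1 by simp
qed

theorem theorem3p2:
  fixes z0 :: real
  assumes "z0 > 0" and "z0 \<noteq> 1"
  shows "(\<nexists>r. universal_escape_radius (complex_of_real z0) 0 r) \<and>
    (\<forall>r::real. r > 0 \<longrightarrow>
      (\<exists>x \<in> exponent_set (complex_of_real z0) 0.
        (\<exists>n. cmod (the (orbit (complex_of_real z0) 0 x n)) > r) \<and>
        orbit_bounded (complex_of_real z0) 0 x))"
proof -
  have large: "\<exists>x \<in> exponent_set (complex_of_real z0) 0.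
      (\<exists>n. cmod (the (orbit (complex_of_real z0) 0 x n)) > r)" if "r > 0" for r
    using exponent_with_large_bounded_orbit[OF assms that] by blast
  have "\<not> universal_escape_radius (complex_of_real z0) 0 r" for r
    using large[of r] unfolding universal_escape_radius_def exponent_set_def by blast
  then show ?thesis
    using large by (auto simp: exponent_set_def)
qed

end
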